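(* Let $p\in(1,2]$ and let $X_1,X_2,\dots$ be i.i.d. real random variables with mean $\mu$ and $\mathbb{E}|X_1-\mu|^p\le \upsilon_p$ for a constant $\upsilon_p>0$. Let $C_p>0$ and let $\phi:\mathbb{R}\to\mathbb{R}$ be a non-decreasing function such that $$-\log(1-x+C_p|x|^p)\le\phi(x)\le\log(1+x+C_p|x|^p)\quad\text{for all }x\in\mathbb{R}.$$ Let $(\lambda_n)_{n\ge1}$ be a non-random sequence of positive numbers with $\lim_{n\to\infty}\lambda_n=0$ and $\sum_{n=1}^\infty\lambda_n^p=\infty$, and let $(t_n)_{n\ge1}$ and $(\tau_n)_{n\ge1}$ be non-random sequences with $0<t_n<1$ and $\tau_n>0$. Let $0<\alpha<1$ and, for $n=1,2,\dots$, let $$I_n(\alpha)=\left\{x\in\mathbb{R}:\ -\log\frac2\alpha-C_p\upsilon_p\sum_{i=1}^n\lambda_i^p\le\sum_{i=1}^n\phi\big(\lambda_i(X_i-x)\big)\le\log\frac2\alpha+C_p\upsilon_p\sum_{i=1}^n\lambda_i^p\right\},$$ $$\varepsilon_n=\alpha\exp\left\{-C_p\upsilon_p\sum_{i=1}^n\lambda_i^p\left(1+t_i^{-(p-1)}\right)\right\}.$$ Let $N$ be the set of all $n\ge1$ such that $$C_p\upsilon_p\sum_{i=1}^n\lambda_i^p\left(1+t_i^{-(p-1)}\right)+\log\frac2\alpha+\log\frac2{\varepsilon_n}\ \le\ \frac{\tau_n^{1/(p-1)}}{(1+\tau_n)^{p/(p-1)}}\cdot\frac{\left(\sum_{i=1}^n\lambda_i\right)^{p/(p-1)}}{\left(C_p\sum_{i=1}^n\lambda_i^p(1-t_i)^{-(p-1)}\right)^{1/(p-1)}}.$$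 Then $$\mathbb{P}\left(|I_n(\alpha)|\le4(1+\tau_n)\,\frac{C_p\upsilon_p\sum_{i=1}^n\lambda_i^p\left(1+t_i^{-(p-1)}\right)+\log\frac2\alpha}{\sum_{i=1}^n\lambda_i}\ \text{ for all } n\in N\right)\ \ge\ 1-\sum_{i=1}^\infty\varepsilon_i .$$
   Context: $|I_n(\alpha)|$ denotes the length of $I_n(\alpha)$, which is an interval because $\phi$ is non-decreasing; when the equations $\sum_{i=1}^n\phi(\lambda_i(X_i-x))=\pm\left(\log\frac2\alpha+C_p\upsilon_p\sum_{i=1}^n\lambda_i^p\right)$ have unique real roots $x_{+,n}$ (for $+$) and $x_{-,n}$ (for $-$), one has $|I_n(\alpha)|=x_{-,n}-x_{+,n}$. The constant $C_p$ is assumed to be such that the logarithms in the bounds on $\phi$ are well defined and such a $\phi$ exists. Logarithms are natural. *)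

theory Defs
  imports "HOL-Probability.Probability"
begin

text \<open>Sequences are functions on \<^typ>\<open>nat\<close> of which only the values at indices
  at least \<open>1\<close> are used. The argument \<open>xs\<close> is a realisation of the sample.\<close>

definition conf_set ::
  "real \<Rightarrow> real \<Rightarrow> real \<Rightarrow> (real \<Rightarrow> real) \<Rightarrow> (nat \<Rightarrow> real) \<Rightarrow> real \<Rightarrow> (nat \<Rightarrow> real) \<Rightarrow> nat \<Rightarrow> real set"
where
  "conf_set p C v \<phi> l \<alpha> xs n =
     {x. - ln (2 / \<alpha>) - C * v * (\<Sum>i=1..n. l i powr p) \<le> (\<Sum>i=1..n. \<phi> (l i * (xs i - x))) \<and>
         (\<Sum>i=1..n. \<phi> (l i * (xs i - x))) \<le> ln (2 / \<alpha>) + C * v * (\<Sum>i=1..n. l i powr p)}"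

text \<open>The length of the interval is taken in \<^typ>\<open>ennreal\<close>: it is \<open>\<infinity>\<close> for
  an unbounded interval (possible, since \<open>\<phi>\<close> may be bounded) and \<open>0\<close> for the empty set.\<close>

definition conf_length ::
  "real \<Rightarrow> real \<Rightarrow> real \<Rightarrow> (real \<Rightarrow> real) \<Rightarrow> (nat \<Rightarrow> real) \<Rightarrow> real \<Rightarrow> (nat \<Rightarrow> real) \<Rightarrow> nat \<Rightarrow> ennreal"
where
  "conf_length p C v \<phi> l \<alpha> xs n = emeasure lborel (conf_set p C v \<phi> l \<alpha> xs n)"

definition err ::
  "real \<Rightarrow> real \<Rightarrow> real \<Rightarrow> (nat \<Rightarrow> real) \<Rightarrow> (nat \<Rightarrow> real) \<Rightarrow> real \<Rightarrow> nat \<Rightarrow> real"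
where
  "err p C v l t \<alpha> n =
     \<alpha> * exp (- (C * v * (\<Sum>i=1..n. l i powr p * (1 + t i powr (-(p - 1))))))"

definition good_indices ::
  "real \<Rightarrow> real \<Rightarrow> real \<Rightarrow> (nat \<Rightarrow> real) \<Rightarrow> (nat \<Rightarrow> real) \<Rightarrow> (nat \<Rightarrow> real) \<Rightarrow> real \<Rightarrow> nat set"
where
  "good_indices p C v l t \<tau> \<alpha> =
     {n. n \<ge> 1 \<and>
         C * v * (\<Sum>i=1..n. l i powr p * (1 + t i powr (-(p - 1))))
           + ln (2 / \<alpha>) + ln (2 / err p C v l t \<alpha> n)
         \<le> (\<tau> n powr (1 / (p - 1)) / (1 + \<tau> n) powr (p / (p - 1)))
           * ((\<Sum>i=1..n. l i) powr (p / (p - 1))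
              / (C * (\<Sum>i=1..n. l i powr p * (1 - t i) powr (-(p - 1)))) powr (1 / (p - 1)))}"

end

theory Submission
  imports Defs
begin

text \<open>Fix \<open>n\<close> and \<open>r = (1 + \<tau>\<^sub>n) K / \<Sum>\<lambda>\<^sub>i\<close>, where \<open>K\<close> is the left-hand side of the inequality
  defining the admissible indices. Chernoff's method at the two points \<open>\<mu> \<plusminus> r\<close>, with the moment
  \<open>E\<bar>X\<^sub>i - x\<bar>\<^sup>p\<close> split by convexity with weights \<open>t\<^sub>i\<close> and \<open>1 - t\<^sub>i\<close>, shows that each of them is outside
  the confidence set, on the correct side, up to probability \<open>\<epsilon>\<^sub>n / 2\<close>; the condition on \<open>n\<close> is exactly
  what makes the resulting deviation bound reach the threshold. By monotonicity of \<open>\<phi>\<close> the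
  confidence set then lies between \<open>\<mu> - r\<close> and \<open>\<mu> + r\<close>, and a union bound over \<open>n\<close> concludes.\<close>

section \<open>Elementary inequalities for powers\<close>

text \<open>Convexity of \<open>u powr p\<close> at the two points \<open>\<bar>a\<bar> / t\<close>
  and \<open>\<bar>b\<bar> / (1 - t)\<close>, whose average with weights \<open>t\<close> and
  \<open>1 - t\<close> is \<open>\<bar>a\<bar> + \<bar>b\<bar>\<close>. The cases
  \<open>a = 0\<close> and \<open>b = 0\<close> are split off so that both points are strictly
  positive.\<close>

lemma abs_add_powr_le:
  fixes a b t p :: real
  assumes p: "1 \<le> p" and t: "0 < t" "t < 1"
  shows "\<bar>a + b\<bar> powr p \<le> t powr (-(p - 1)) * \<bar>a\<bar> powr p + (1 - t) powr (-(p - 1)) * \<bar>b\<bar> powr p"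
proof -
  \<comment> \<open>A base below 1 with a nonpositive exponent gives a factor of at least 1; this
    settles the degenerate cases.\<close>
  have ge: "c powr p \<le> s powr (-(p - 1)) * c powr p" if "0 < s" "s < 1" for s c :: real
    using mult_right_mono[of 1 "s powr (-(p - 1))" "c powr p"] powr_mono'[of "-(p - 1)" 0 s] that p by simp
  have scale: "s * (c / s) powr p = s powr (-(p - 1)) * c powr p" if "0 < s" "0 < c" for s c :: real
  proof -
    have "s powr (-(p - 1)) = s / s powr p"
      using that powr_diff[of s 1 p] by simp
    thus ?thesis
      using that by (simp add: powr_divide)
  qed
  consider "a = 0" | "b = 0" | "a \<noteq> 0" "b \<noteq> 0" by blast
  thus ?thesis
  proof cases
    case 1
    thus ?thesis using ge[of "1 - t" "\<bar>b\<bar>"] t p by simp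
  next
    case 2
    thus ?thesis using ge[of t "\<bar>a\<bar>"] t p by simp
  next
    case 3
    have "\<bar>a + b\<bar> powr p \<le> (\<bar>a\<bar> + \<bar>b\<bar>) powr p"
      using p by (intro powr_mono2) auto
    also have "\<bar>a\<bar> + \<bar>b\<bar> = (1 - t) *\<^sub>R (\<bar>b\<bar> / (1 - t)) + t *\<^sub>R (\<bar>a\<bar> / t)"
      using t by simp
    also have "\<dots> powr p \<le> (1 - t) * (\<bar>b\<bar> / (1 - t)) powr p + t * (\<bar>a\<bar> / t) powr p"
      using 3 t by (intro convex_onD[OF powr_convex[OF p]]) auto
    also have "t * (\<bar>a\<bar> / t) powr p = t powr (-(p - 1)) * \<bar>a\<bar> powr p"
      using 3 t by (intro scale) auto
    also have "(1 - t) * (\<bar>b\<bar> / (1 - t)) powr p = (1 - t) powr (-(p - 1)) * \<bar>b\<bar> powr p"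
      using 3 t by (intro scale) auto
    finally show ?thesis by (simp only: add.commute)
  qed
qed

text \<open>With \<open>r = (1 + \<tau>) * K / S\<close> the claim is
  \<open>B * r powr p \<le> \<tau> * K\<close>. Raising the hypothesis to the power
  \<open>p - 1\<close> removes all the roots and bounds \<open>K powr (p - 1)\<close>; one more
  factor \<open>K\<close> gives the claim. Since \<open>S * r = (1 + \<tau>) * K\<close>, the linear
  gain \<open>S * r\<close> then exceeds the cost \<open>B * r powr p\<close> by at least
  \<open>K\<close>.\<close>

lemma scaled_root_inequality:
  fixes K S B \<tau> p :: real
  assumes p: "1 < p" and pos: "0 < K" "0 < S" "0 < B" "0 < \<tau>"
    and K: "K \<le> (\<tau> powr (1 / (p - 1)) / (1 + \<tau>) powr (p / (p - 1)))
                 * (S powr (p / (p - 1)) / B powr (1 / (p - 1)))"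
  shows "K + B * ((1 + \<tau>) * K / S) powr p \<le> (1 + \<tau>) * K"
proof -
  have "K powr (p - 1) \<le> ((\<tau> powr (1 / (p - 1)) / (1 + \<tau>) powr (p / (p - 1)))
                 * (S powr (p / (p - 1)) / B powr (1 / (p - 1)))) powr (p - 1)"
    using K p pos by (intro powr_mono2) auto
  also have "\<dots> = \<tau> / (1 + \<tau>) powr p * (S powr p / B)"
    using p pos by (simp add: powr_mult powr_divide powr_powr)
  finally have *: "K powr (p - 1) \<le> \<tau> / (1 + \<tau>) powr p * (S powr p / B)" .
  have "K powr p = K * K powr (p - 1)"
    using pos by (simp add: powr_mult_base)
  hence "B * ((1 + \<tau>) * K / S) powr p = (B * (1 + \<tau>) powr p * K / S powr p) * K powr (p - 1)"
    using pos by (simp add: powr_mult powr_divide)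
  also have "\<dots> \<le> (B * (1 + \<tau>) powr p * K / S powr p) * (\<tau> / (1 + \<tau>) powr p * (S powr p / B))"
    using * pos by (intro mult_left_mono) auto
  also have "\<dots> = \<tau> * K"
    using pos by simp
  finally show ?thesis by (simp add: algebra_simps)
qed

section \<open>Moments and exponential deviation bounds\<close>

text \<open>Split \<open>Z - x\<close> into the random part \<open>Z - \<mu>\<close>, which gets
  weight \<open>t\<close>, and the constant \<open>\<mu> - x\<close>, which gets weight
  \<open>1 - t\<close>. The pointwise bound also dominates the integrand, hence
  integrability.\<close>

lemma (in prob_space) expectation_shifted_powr_le:
  fixes Z :: "'a \<Rightarrow> real"
  assumes p: "1 \<le> p" and t: "0 < t" "t < 1"
    and Z [measurable]: "random_variable borel Z"
    and int: "integrable M (\<lambda>\<omega>. \<bar>Z \<omega> - \<mu>\<bar> powr p)"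
    and v: "expectation (\<lambda>\<omega>. \<bar>Z \<omega> - \<mu>\<bar> powr p) \<le> v"
  shows "integrable M (\<lambda>\<omega>. \<bar>Z \<omega> - x\<bar> powr p)"
    and "expectation (\<lambda>\<omega>. \<bar>Z \<omega> - x\<bar> powr p)
           \<le> t powr (-(p - 1)) * v + (1 - t) powr (-(p - 1)) * \<bar>x - \<mu>\<bar> powr p"
proof -
  let ?g = "\<lambda>\<omega>. t powr (-(p - 1)) * \<bar>Z \<omega> - \<mu>\<bar> powr p + (1 - t) powr (-(p - 1)) * \<bar>\<mu> - x\<bar> powr p"
  have le: "\<bar>Z \<omega> - x\<bar> powr p \<le> ?g \<omega>" for \<omega>
    using abs_add_powr_le[OF p t, of "Z \<omega> - \<mu>" "\<mu> - x"] by simp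
  have g: "integrable M ?g"
    using int by simp
  show int': "integrable M (\<lambda>\<omega>. \<bar>Z \<omega> - x\<bar> powr p)"
    by (rule Bochner_Integration.integrable_bound[OF g]) (auto intro!: AE_I2 order.trans[OF le])
  have "expectation (\<lambda>\<omega>. \<bar>Z \<omega> - x\<bar> powr p) \<le> expectation ?g"
    by (rule integral_mono[OF int' g le])
  also have "\<dots> = t powr (-(p - 1)) * expectation (\<lambda>\<omega>. \<bar>Z \<omega> - \<mu>\<bar> powr p)
      + (1 - t) powr (-(p - 1)) * \<bar>\<mu> - x\<bar> powr p"
    using int by (simp add: prob_space)
  also have "\<dots> \<le> t powr (-(p - 1)) * v + (1 - t) powr (-(p - 1)) * \<bar>\<mu> - x\<bar> powr p"
    using v by (intro add_right_mono mult_left_mono) auto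
  finally show "expectation (\<lambda>\<omega>. \<bar>Z \<omega> - x\<bar> powr p)
           \<le> t powr (-(p - 1)) * v + (1 - t) powr (-(p - 1)) * \<bar>x - \<mu>\<bar> powr p"
    by (simp add: abs_minus_commute)
qed

text \<open>Markov's inequality is applied to the product of the \<open>Y i\<close>, not to the
  exponential of the sum of the \<open>F i\<close>: its mean factorises by independence, and each
  factor is at most \<open>exp (b i)\<close> because \<open>1 + u \<le> exp u\<close>. The bound
  \<open>F i \<omega> \<le> ln (Y i \<omega>)\<close> places the event inside a superlevel set of
  that product.\<close>

lemma (in prob_space) chernoff_indep_sum:
  fixes F Y :: "nat \<Rightarrow> 'a \<Rightarrow> real" and b :: "nat \<Rightarrow> real"
  assumes fin: "finite I" and \<delta>: "0 < \<delta>"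
    and indep: "indep_vars (\<lambda>_. borel) Y I"
    and pos: "\<And>i \<omega>. i \<in> I \<Longrightarrow> 0 < Y i \<omega>"
    and int: "\<And>i. i \<in> I \<Longrightarrow> integrable M (Y i)"
    and bound: "\<And>i. i \<in> I \<Longrightarrow> expectation (Y i) \<le> 1 + b i"
    and F: "\<And>i \<omega>. i \<in> I \<Longrightarrow> F i \<omega> \<le> ln (Y i \<omega>)"
  shows "prob {\<omega> \<in> space M. ln (1 / \<delta>) + (\<Sum>i\<in>I. b i) \<le> (\<Sum>i\<in>I. F i \<omega>)} \<le> \<delta>"
proof -
  let ?P = "\<lambda>\<omega>. \<Prod>i\<in>I. Y i \<omega>"
  let ?c = "exp (ln (1 / \<delta>) + (\<Sum>i\<in>I. b i))"
  have P: "integrable M ?P" "expectation ?P = (\<Prod>i\<in>I. expectation (Y i))"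
    using indep_vars_integrable[OF fin indep int] indep_vars_lebesgue_integral[OF fin indep int] by auto
  have [measurable]: "?P \<in> borel_measurable M"
    using P(1) by simp
  have "(\<Prod>i\<in>I. expectation (Y i)) \<le> (\<Prod>i\<in>I. exp (b i))"
  proof (intro prod_mono conjI)
    fix i assume i: "i \<in> I"
    show "0 \<le> expectation (Y i)"
      using pos[OF i] by (intro integral_nonneg_AE AE_I2 less_imp_le)
    show "expectation (Y i) \<le> exp (b i)"
      using bound[OF i] exp_ge_add_one_self[of "b i"] by linarith
  qed
  hence E: "expectation ?P \<le> exp (\<Sum>i\<in>I. b i)"
    using P(2) fin by (simp add: exp_sum)
  have "prob {\<omega> \<in> space M. ln (1 / \<delta>) + (\<Sum>i\<in>I. b i) \<le> (\<Sum>i\<in>I. F i \<omega>)}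
      \<le> prob {\<omega> \<in> space M. ?c \<le> ?P \<omega>}"
  proof (intro finite_measure_mono subsetI)
    fix \<omega> assume "\<omega> \<in> {\<omega> \<in> space M. ln (1 / \<delta>) + (\<Sum>i\<in>I. b i) \<le> (\<Sum>i\<in>I. F i \<omega>)}"
    hence \<omega>: "\<omega> \<in> space M" "ln (1 / \<delta>) + (\<Sum>i\<in>I. b i) \<le> (\<Sum>i\<in>I. F i \<omega>)" by auto
    have "(\<Sum>i\<in>I. F i \<omega>) \<le> (\<Sum>i\<in>I. ln (Y i \<omega>))"
      using F by (intro sum_mono) auto
    with \<omega>(2) have "?c \<le> exp (\<Sum>i\<in>I. ln (Y i \<omega>))" by simp
    also have "\<dots> = ?P \<omega>"
      using pos fin by (simp add: exp_sum)
    finally show "\<omega> \<in> {\<omega> \<in> space M. ?c \<le> ?P \<omega>}" using \<omega>(1) by simp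
  qed simp
  also have "\<dots> \<le> expectation ?P / ?c"
    using P(1) pos by (intro integral_Markov_inequality_measure[where A = "{}"])
      (auto intro!: AE_I2 prod_nonneg simp: less_imp_le)
  also have "\<dots> \<le> exp (\<Sum>i\<in>I. b i) / ?c"
    using E by (intro divide_right_mono) auto
  also have "\<dots> = \<delta>"
    using \<delta> by (simp add: exp_add)
  finally show ?thesis .
qed

text \<open>The sign \<open>s\<close> treats both tails at once: \<open>s = 1\<close> uses the upper
  bound on \<open>\<phi>\<close> at the point \<mu> + r, and \<open>s = -1\<close> the lower bound
  at \<mu> - r. In both cases the shift away from \<mu> gives each summand a drift of
  \<open>- l i * r\<close>, which competes with a term of order \<open>r powr p\<close> from the
  moment bound.\<close>

lemma (in prob_space) one_sided_deviation:
  fixes X :: "nat \<Rightarrow> 'a \<Rightarrow> real" and \<phi> :: "real \<Rightarrow> real" and l t :: "nat \<Rightarrow> real"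
  assumes p: "1 < p"
    and indep: "indep_vars (\<lambda>_. borel) X {1..}"
    and ident: "\<And>i. i \<ge> 1 \<Longrightarrow> distr M borel (X i) = distr M borel (X 1)"
    and mean: "integrable M (X 1)" "expectation (X 1) = \<mu>"
    and moment: "integrable M (\<lambda>\<omega>. \<bar>X 1 \<omega> - \<mu>\<bar> powr p)"
      "expectation (\<lambda>\<omega>. \<bar>X 1 \<omega> - \<mu>\<bar> powr p) \<le> v"
    and C: "C > 0"
    and s: "\<bar>s\<bar> = 1"
    and pos: "\<And>y. 0 < 1 + s * y + C * \<bar>y\<bar> powr p"
    and phi: "\<And>y. s * \<phi> y \<le> ln (1 + s * y + C * \<bar>y\<bar> powr p)"
    and l_pos: "\<And>n. n \<ge> 1 \<Longrightarrow> l n > 0"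
    and t: "\<And>n. n \<ge> 1 \<Longrightarrow> 0 < t n \<and> t n < 1"
    and \<delta>: "0 < \<delta>" and r: "0 \<le> r"
  shows "prob {\<omega> \<in> space M. ln (1 / \<delta>) - (\<Sum>i=1..n. l i) * r
            + C * v * (\<Sum>i=1..n. l i powr p * t i powr (-(p - 1)))
            + C * (\<Sum>i=1..n. l i powr p * (1 - t i) powr (-(p - 1))) * r powr p
          \<le> s * (\<Sum>i=1..n. \<phi> (l i * (X i \<omega> - (\<mu> + s * r))))} \<le> \<delta>"
proof -
  let ?x = "\<mu> + s * r"
  \<comment> \<open>\<open>1 + b i\<close> will bound the mean of \<open>f i (X i \<omega>)\<close>,
    where \<open>f i\<close> is the argument of the logarithm that dominates
    \<open>s * \<phi>\<close>. The summand \<open>- (l i * r)\<close> is the mean of the linear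
    term, and the rest is the split moment at distance \<open>r\<close> from \<mu>.\<close>
  define b where "b = (\<lambda>i. - (l i * r) + C * l i powr p *
     (t i powr (-(p - 1)) * v + (1 - t i) powr (-(p - 1)) * r powr p))"
  define f where "f = (\<lambda>i z. 1 + s * (l i * (z - ?x)) + C * \<bar>l i * (z - ?x)\<bar> powr p)"
  have rv [measurable]: "random_variable borel (X i)" if "i \<ge> 1" for i
    using indep that by (auto simp: indep_vars_def)
  have ss: "s * s = 1" using s by (metis abs_mult_self_eq mult_1)
  have transfer: "integrable M (\<lambda>\<omega>. h (X i \<omega>)) = integrable M (\<lambda>\<omega>. h (X 1 \<omega>))"
      "expectation (\<lambda>\<omega>. h (X i \<omega>)) = expectation (\<lambda>\<omega>. h (X 1 \<omega>))"
    if "i \<ge> 1" and [measurable]: "h \<in> borel_measurable borel" for i and h :: "real \<Rightarrow> real"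
    using that ident[OF that(1)] integrable_distr_eq[OF rv that(2), of i] integrable_distr_eq[OF rv that(2), of 1]
      integral_distr[OF rv that(2), of i] integral_distr[OF rv that(2), of 1]
    by auto
  have fX: "integrable M (\<lambda>\<omega>. f i (X i \<omega>)) \<and> expectation (\<lambda>\<omega>. f i (X i \<omega>)) \<le> 1 + b i" if i: "i \<ge> 1" for i
  proof -
    have Xi: "integrable M (X i)" "expectation (X i) = \<mu>"
      using transfer[OF i, of "\<lambda>z. z"] mean by auto
    have "integrable M (\<lambda>\<omega>. \<bar>X i \<omega> - \<mu>\<bar> powr p)" "expectation (\<lambda>\<omega>. \<bar>X i \<omega> - \<mu>\<bar> powr p) \<le> v"
      using transfer[OF i, of "\<lambda>z. \<bar>z - \<mu>\<bar> powr p"] moment by simp_all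
    note E = expectation_shifted_powr_le[OF less_imp_le[OF p] _ _ rv[OF i] this, of "t i" ?x]
    have f_eq: "f i z = 1 + s * l i * (z - ?x) + C * l i powr p * \<bar>z - ?x\<bar> powr p" for z
      using l_pos[OF i] by (simp add: f_def abs_mult powr_mult)
    have int: "integrable M (\<lambda>\<omega>. f i (X i \<omega>))"
      unfolding f_eq using E(1) t[OF i] Xi(1) by auto
    have "expectation (\<lambda>\<omega>. f i (X i \<omega>))
        = 1 + s * l i * (\<mu> - ?x) + C * l i powr p * expectation (\<lambda>\<omega>. \<bar>X i \<omega> - ?x\<bar> powr p)"
      unfolding f_eq using E(1) t[OF i] Xi by (simp add: prob_space)
    also have "s * l i * (\<mu> - ?x) = - (l i * r)"
      using ss by (simp add: algebra_simps)
    also have "1 + - (l i * r) + C * l i powr p * expectation (\<lambda>\<omega>. \<bar>X i \<omega> - ?x\<bar> powr p) \<le> 1 + b i"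
      unfolding b_def using E(2) t[OF i] C r s
      by (auto simp: abs_mult intro!: mult_left_mono)
    finally show ?thesis using int by blast
  qed
  have f_meas: "f i \<in> borel_measurable borel" for i
    unfolding f_def by measurable
  have "indep_vars (\<lambda>_. borel) (\<lambda>i \<omega>. f i (X i \<omega>)) {1..n}"
    by (rule indep_vars_compose2[OF indep_vars_subset[OF indep] f_meas]) simp
  hence "prob {\<omega> \<in> space M. ln (1 / \<delta>) + (\<Sum>i=1..n. b i)
      \<le> (\<Sum>i=1..n. s * \<phi> (l i * (X i \<omega> - ?x)))} \<le> \<delta>"
  proof (intro chernoff_indep_sum[OF _ \<delta>, where Y = "\<lambda>i \<omega>. f i (X i \<omega>)"])
    show "0 < f i (X i \<omega>)" "s * \<phi> (l i * (X i \<omega> - ?x)) \<le> ln (f i (X i \<omega>))" for i \<omega>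
      unfolding f_def by (rule pos, rule phi)
  qed (use fX in simp_all)
  moreover have "ln (1 / \<delta>) + (\<Sum>i=1..n. b i) = ln (1 / \<delta>) - (\<Sum>i=1..n. l i) * r
            + C * v * (\<Sum>i=1..n. l i powr p * t i powr (-(p - 1)))
            + C * (\<Sum>i=1..n. l i powr p * (1 - t i) powr (-(p - 1))) * r powr p"
    by (simp add: b_def sum.distrib sum_subtractf ring_distribs mult_ac flip: sum_distrib_left sum_distrib_right)
  ultimately show ?thesis
    by (simp only: sum_distrib_left)
qed

section \<open>Measurability and location of the confidence set\<close>

text \<open>The confidence set is the section at \<omega> of a measurable subset of the product with
  the real line, and the Lebesgue measure of a section is a measurable function of \<omega>.\<close>

lemma measurable_conf_length:
  fixes X :: "nat \<Rightarrow> 'a \<Rightarrow> real"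
  assumes [measurable]: "\<And>i. i \<ge> 1 \<Longrightarrow> X i \<in> borel_measurable M" "\<phi> \<in> borel_measurable borel"
  shows "(\<lambda>\<omega>. conf_length p C v \<phi> l \<alpha> (\<lambda>i. X i \<omega>) n) \<in> borel_measurable M"
proof -
  have [measurable]: "(\<lambda>q. \<Sum>i=1..n. \<phi> (l i * (X i (fst q) - snd q))) \<in> borel_measurable (M \<Otimes>\<^sub>M lborel)"
    by (intro borel_measurable_sum) simp
  show ?thesis
    unfolding conf_length_def conf_set_def
  proof (rule lborel.measurable_emeasure)
    show "{q \<in> space (M \<Otimes>\<^sub>M lborel). snd q \<in> {x.
        - ln (2 / \<alpha>) - C * v * (\<Sum>i=1..n. l i powr p) \<le> (\<Sum>i=1..n. \<phi> (l i * (X i (fst q) - x))) \<and>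
        (\<Sum>i=1..n. \<phi> (l i * (X i (fst q) - x))) \<le> ln (2 / \<alpha>) + C * v * (\<Sum>i=1..n. l i powr p)}}
      \<in> sets (M \<Otimes>\<^sub>M lborel)"
      unfolding mem_Collect_eq by measurable
  qed simp
qed

text \<open>The sum is nonincreasing in the candidate point, because \<open>\<phi>\<close> is
  nondecreasing and the \<open>l i\<close> are positive. So to the right of \<open>b\<close> it
  stays below the lower threshold, and to the left of \<open>a\<close> above the upper one.\<close>

lemma conf_set_subset:
  fixes \<phi> :: "real \<Rightarrow> real"
  assumes "mono \<phi>" and l: "\<And>i. i \<ge> 1 \<Longrightarrow> l i > 0"
    and upper: "(\<Sum>i=1..n. \<phi> (l i * (xs i - b))) < - ln (2 / \<alpha>) - C * v * (\<Sum>i=1..n. l i powr p)"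
    and lower: "ln (2 / \<alpha>) + C * v * (\<Sum>i=1..n. l i powr p) < (\<Sum>i=1..n. \<phi> (l i * (xs i - a)))"
  shows "conf_set p C v \<phi> l \<alpha> xs n \<subseteq> {a..b}"
proof
  fix x assume x: "x \<in> conf_set p C v \<phi> l \<alpha> xs n"
  have anti: "(\<Sum>i=1..n. \<phi> (l i * (xs i - z))) \<le> (\<Sum>i=1..n. \<phi> (l i * (xs i - y)))" if "y \<le> z" for y z
    using that l by (intro sum_mono monoD[OF assms(1)] mult_left_mono) (auto intro: less_imp_le)
  have "\<not> x \<le> a" "\<not> b \<le> x"
    using x upper lower anti[of x a] anti[of b x] unfolding conf_set_def mem_Collect_eq by linarith+
  thus "x \<in> {a..b}" by simp
qed

section \<open>Union bound and conclusion\<close>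

text \<open>Extended reals allow the error series to diverge; the right-hand side is then minus
  infinity. Otherwise countable subadditivity applies. The shift by \<open>Suc\<close> matches a
  series starting at 0 with indices starting at 1.\<close>

lemma (in prob_space) prob_all_ge_union_bound:
  fixes e :: "nat \<Rightarrow> real"
  assumes meas: "\<And>n. n \<in> G \<Longrightarrow> {\<omega> \<in> space M. P n \<omega>} \<in> events"
    and G: "G \<subseteq> {1..}" and e: "\<And>n. 0 \<le> e n"
    and bad: "\<And>n. n \<in> G \<Longrightarrow> prob {\<omega> \<in> space M. \<not> P n \<omega>} \<le> e n"
  shows "ereal (prob {\<omega> \<in> space M. \<forall>n\<in>G. P n \<omega>}) \<ge> 1 - (\<Sum>i. ereal (e (Suc i)))"
proof (cases "(\<Sum>i. ereal (e (Suc i))) = \<infinity>")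
  case True
  hence "1 - (\<Sum>i. ereal (e (Suc i))) = - \<infinity>"
    by (simp add: one_ereal_def)
  thus ?thesis by simp
next
  case False
  \<comment> \<open>Indices outside \<open>G\<close> contribute the empty set, so the bad events
    become a sequence over all naturals.\<close>
  define A where "A = (\<lambda>i. if Suc i \<in> G then {\<omega> \<in> space M. \<not> P (Suc i) \<omega>} else {})"
  have A_events: "A i \<in> events" for i
    using sets.sets_Collect_neg[OF meas, of "Suc i"] by (simp add: A_def)
  have A_le: "prob (A i) \<le> e (Suc i)" for i
    using bad e by (auto simp: A_def)
  have sum_e: "summable (\<lambda>i. e (Suc i))"
    using False e by (intro summable_ereal) auto
  have sum_A: "summable (\<lambda>i. prob (A i))"
    by (rule summable_comparison_test'[OF sum_e]) (use A_le in auto)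
  have "{\<omega> \<in> space M. \<forall>n\<in>G. P n \<omega>} = space M - (\<Union>i. A i)"
  proof (intro equalityI subsetI)
    fix \<omega> assume \<omega>: "\<omega> \<in> space M - (\<Union>i. A i)"
    have "P n \<omega>" if "n \<in> G" for n
      using \<omega> that G by (cases n) (auto simp: A_def)
    thus "\<omega> \<in> {\<omega> \<in> space M. \<forall>n\<in>G. P n \<omega>}" using \<omega> by auto
  qed (auto simp: A_def split: if_splits)
  hence "prob {\<omega> \<in> space M. \<forall>n\<in>G. P n \<omega>} = 1 - prob (\<Union>i. A i)"
    using A_events by (simp add: prob_compl)
  moreover have "prob (\<Union>i. A i) \<le> (\<Sum>i. prob (A i))"
    using A_events sum_A by (intro finite_measure_subadditive_countably) auto
  moreover have "\<dots> \<le> (\<Sum>i. e (Suc i))"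
    by (intro suminf_le A_le sum_A sum_e)
  ultimately show ?thesis
    using suminf_ereal'[OF sum_e] by (simp add: one_ereal_def)
qed

theorem theorem3:
  fixes M :: "'a measure"
    and X :: "nat \<Rightarrow> 'a \<Rightarrow> real"
    and p \<mu> v C \<alpha> :: real
    and \<phi> :: "real \<Rightarrow> real"
    and l t \<tau> :: "nat \<Rightarrow> real"
  assumes "prob_space M"
    and p: "1 < p" "p \<le> 2"
    and indep: "prob_space.indep_vars M (\<lambda>_. borel) X {1..}"
    and ident: "\<And>i. i \<ge> 1 \<Longrightarrow> distr M borel (X i) = distr M borel (X 1)"
    and mean: "integrable M (X 1)" "(\<integral>\<omega>. X 1 \<omega> \<partial>M) = \<mu>"
    and v: "v > 0"
    and moment: "integrable M (\<lambda>\<omega>. \<bar>X 1 \<omega> - \<mu>\<bar> powr p)"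
      "(\<integral>\<omega>. \<bar>X 1 \<omega> - \<mu>\<bar> powr p \<partial>M) \<le> v"
    and C: "C > 0"
    and log_defined: "\<And>x. 1 - x + C * \<bar>x\<bar> powr p > 0" "\<And>x. 1 + x + C * \<bar>x\<bar> powr p > 0"
    and phi_mono: "mono \<phi>"
    and phi_lower: "\<And>x. - ln (1 - x + C * \<bar>x\<bar> powr p) \<le> \<phi> x"
    and phi_upper: "\<And>x. \<phi> x \<le> ln (1 + x + C * \<bar>x\<bar> powr p)"
    and l_pos: "\<And>n. n \<ge> 1 \<Longrightarrow> l n > 0"
    and l_lim: "l \<longlonglongrightarrow> 0"
    and l_sum: "filterlim (\<lambda>n. \<Sum>i=1..n. l i powr p) at_top sequentially"
    and t: "\<And>n. n \<ge> 1 \<Longrightarrow> 0 < t n \<and> t n < 1"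
    and tau: "\<And>n. n \<ge> 1 \<Longrightarrow> \<tau> n > 0"
    and alpha: "0 < \<alpha>" "\<alpha> < 1"
  shows "ereal (measure M {\<omega> \<in> space M. \<forall>n \<in> good_indices p C v l t \<tau> \<alpha>.
            conf_length p C v \<phi> l \<alpha> (\<lambda>i. X i \<omega>) n
            \<le> ennreal (4 * (1 + \<tau> n)
                * ((C * v * (\<Sum>i=1..n. l i powr p * (1 + t i powr (-(p - 1)))) + ln (2 / \<alpha>))
                   / (\<Sum>i=1..n. l i)))})
         \<ge> 1 - (\<Sum>i. ereal (err p C v l t \<alpha> (Suc i)))"
proof -
  interpret prob_space M by fact
  let ?G = "good_indices p C v l t \<tau> \<alpha>"
  let ?e = "err p C v l t \<alpha>"
  have rv: "random_variable borel (X i)" if "i \<ge> 1" for i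
    using indep that by (auto simp: indep_vars_def)
  have phi_meas: "\<phi> \<in> borel_measurable borel"
    using phi_mono by (rule borel_measurable_mono)
  have e_pos: "0 < ?e n" for n
    using alpha by (simp add: err_def)
  show ?thesis
  proof (rule prob_all_ge_union_bound)
    fix n assume "n \<in> ?G"
    show "{\<omega> \<in> space M. conf_length p C v \<phi> l \<alpha> (\<lambda>i. X i \<omega>) n
            \<le> ennreal (4 * (1 + \<tau> n)
                * ((C * v * (\<Sum>i=1..n. l i powr p * (1 + t i powr (-(p - 1)))) + ln (2 / \<alpha>))
                   / (\<Sum>i=1..n. l i)))} \<in> events"
      using measurable_conf_length[OF rv phi_meas] by measurable
  next
    fix n assume n: "n \<in> ?G"
    hence n1: "n \<ge> 1" by (simp add: good_indices_def)
    define S where "S = (\<Sum>i=1..n. l i)"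
    define L where "L = C * v * (\<Sum>i=1..n. l i powr p)"
    define A where "A = C * v * (\<Sum>i=1..n. l i powr p * t i powr (-(p - 1)))"
    define B where "B = C * (\<Sum>i=1..n. l i powr p * (1 - t i) powr (-(p - 1)))"
    \<comment> \<open>This is the left-hand side of the condition on \<open>n\<close>: by
      \<open>ln_e\<close> below, its last logarithm equals
      \<open>ln (2 / \<alpha>) + (L + A)\<close>, so everything occurs twice. This 2 and the width
      \<open>2 * r\<close> of the enclosing interval make the constant 4.\<close>
    define K where "K = 2 * (L + A + ln (2 / \<alpha>))"
    define r where "r = (1 + \<tau> n) * K / S"
    \<comment> \<open>Outside \<open>U\<close> the sum at \<mu> + r is below the lower threshold,
      and outside \<open>V\<close> the sum at \<mu> - r is above the upper one. The factors
      \<open>1\<close> and \<open>-1\<close> are kept to match \<open>one_sided_deviation\<close>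
      with \<open>s = 1\<close> and \<open>s = -1\<close>, each at level
      \<open>?e n / 2\<close>.\<close>
    define U where "U = {\<omega> \<in> space M. ln (1 / (?e n / 2)) - S * r + A + B * r powr p
          \<le> 1 * (\<Sum>i=1..n. \<phi> (l i * (X i \<omega> - (\<mu> + 1 * r))))}"
    define V where "V = {\<omega> \<in> space M. ln (1 / (?e n / 2)) - S * r + A + B * r powr p
          \<le> -1 * (\<Sum>i=1..n. \<phi> (l i * (X i \<omega> - (\<mu> + -1 * r))))}"
    have LA: "C * v * (\<Sum>i=1..n. l i powr p * (1 + t i powr (-(p - 1)))) = L + A"
      by (simp add: L_def A_def algebra_simps sum.distrib)
    have S_pos: "S > 0"
      unfolding S_def using n1 l_pos by (intro sum_pos) auto
    have B_pos: "B > 0"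
      unfolding B_def using n1 l_pos[THEN less_imp_neq] t[THEN conjunct2, THEN less_imp_neq] C
      by (intro mult_pos_pos sum_pos) auto
    have "L \<ge> 0" "A \<ge> 0"
      unfolding L_def A_def using C v by (auto intro!: mult_nonneg_nonneg sum_nonneg)
    moreover have "ln (2 / \<alpha>) > 0"
      using alpha by simp
    ultimately have K_pos: "K > 0" by (simp add: K_def)
    have tau_n: "\<tau> n > 0" using tau n1 .
    have ln_e: "ln (2 / ?e n) = ln (2 / \<alpha>) + (L + A)"
      using alpha unfolding err_def LA by (simp add: ln_div ln_mult)
    have "K \<le> (\<tau> n powr (1 / (p - 1)) / (1 + \<tau> n) powr (p / (p - 1)))
        * (S powr (p / (p - 1)) / B powr (1 / (p - 1)))"
      using n unfolding good_indices_def mem_Collect_eq LA ln_e K_def B_def S_def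
      by (simp only: mult_2 add_ac)
    hence "K + B * r powr p \<le> (1 + \<tau> n) * K"
      unfolding r_def using p K_pos S_pos B_pos tau_n by (intro scaled_root_inequality) auto
    hence "K + B * r powr p \<le> S * r"
      using S_pos by (simp add: r_def)
    \<comment> \<open>Replacing \<open>B * r powr p - S * r\<close> by its upper bound
      \<open>- K\<close> leaves \<open>ln (2 / ?e n) + A - K\<close>, which is exactly the
      right-hand side.\<close>
    hence reach: "ln (1 / (?e n / 2)) - S * r + A + B * r powr p \<le> - ln (2 / \<alpha>) - L"
      using ln_e by (simp add: K_def)
    have r_nonneg: "r \<ge> 0"
      unfolding r_def using K_pos S_pos tau_n by simp
    have "prob U \<le> ?e n / 2"
      unfolding U_def S_def A_def B_def
      using phi_upper log_defined(2) e_pos[of n] r_nonneg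
      by (intro one_sided_deviation[OF p(1) indep ident mean moment C _ _ _ l_pos t]) simp_all
    moreover have "prob V \<le> ?e n / 2"
      unfolding V_def S_def A_def B_def
    proof (rule one_sided_deviation[OF p(1) indep ident mean moment C _ _ _ l_pos t])
      \<comment> \<open>For the left point, the negated lower bound on \<open>\<phi>\<close> is the
        upper bound required on \<open>- \<phi>\<close>.\<close>
      show "-1 * \<phi> y \<le> ln (1 + -1 * y + C * \<bar>y\<bar> powr p)" for y
        using phi_lower[of y] by simp
    qed (use log_defined(1) e_pos[of n] r_nonneg in simp_all)
    moreover have "U \<in> events" "V \<in> events"
      unfolding U_def V_def using rv phi_meas by measurable
    ultimately have UV: "prob (U \<union> V) \<le> ?e n" "U \<union> V \<in> events"
      using measure_Un_le[of U M V] by auto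
    have "{\<omega> \<in> space M. \<not> conf_length p C v \<phi> l \<alpha> (\<lambda>i. X i \<omega>) n
            \<le> ennreal (4 * (1 + \<tau> n)
                * ((C * v * (\<Sum>i=1..n. l i powr p * (1 + t i powr (-(p - 1)))) + ln (2 / \<alpha>))
                   / (\<Sum>i=1..n. l i)))} \<subseteq> U \<union> V"
    proof (rule ccontr)
      assume "\<not> ?thesis"
      then obtain \<omega> where \<omega>: "\<omega> \<in> space M" "\<omega> \<notin> U" "\<omega> \<notin> V"
        and long: "\<not> conf_length p C v \<phi> l \<alpha> (\<lambda>i. X i \<omega>) n
            \<le> ennreal (4 * (1 + \<tau> n) * ((L + A + ln (2 / \<alpha>)) / S))"
        unfolding LA S_def[symmetric] subset_iff by auto
      have "conf_set p C v \<phi> l \<alpha> (\<lambda>i. X i \<omega>) n \<subseteq> {\<mu> + -1 * r..\<mu> + 1 * r}"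
      proof (rule conf_set_subset[OF phi_mono l_pos])
        have "\<not> (ln (1 / (?e n / 2)) - S * r + A + B * r powr p
            \<le> 1 * (\<Sum>i=1..n. \<phi> (l i * (X i \<omega> - (\<mu> + 1 * r)))))"
          using \<omega>(1,2) unfolding U_def by blast
        thus "(\<Sum>i=1..n. \<phi> (l i * (X i \<omega> - (\<mu> + 1 * r)))) < - ln (2 / \<alpha>) - C * v * (\<Sum>i=1..n. l i powr p)"
          using reach unfolding L_def by linarith
        have "\<not> (ln (1 / (?e n / 2)) - S * r + A + B * r powr p
            \<le> -1 * (\<Sum>i=1..n. \<phi> (l i * (X i \<omega> - (\<mu> + -1 * r)))))"
          using \<omega>(1,3) unfolding V_def by blast
        thus "ln (2 / \<alpha>) + C * v * (\<Sum>i=1..n. l i powr p) < (\<Sum>i=1..n. \<phi> (l i * (X i \<omega> - (\<mu> + -1 * r))))"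
          using reach unfolding L_def by linarith
      qed
      hence "conf_length p C v \<phi> l \<alpha> (\<lambda>i. X i \<omega>) n \<le> emeasure lborel {\<mu> + -1 * r..\<mu> + 1 * r}"
        unfolding conf_length_def by (intro emeasure_mono) auto
      also have "\<dots> = ennreal (2 * r)"
        using r_nonneg by simp
      also have "2 * r = 4 * (1 + \<tau> n) * ((L + A + ln (2 / \<alpha>)) / S)"
        using S_pos by (simp add: r_def K_def field_simps)
      finally show False using long by simp
    qed
    from finite_measure_mono[OF this UV(2)] UV(1)
    show "prob {\<omega> \<in> space M. \<not> conf_length p C v \<phi> l \<alpha> (\<lambda>i. X i \<omega>) n
            \<le> ennreal (4 * (1 + \<tau> n)
                * ((C * v * (\<Sum>i=1..n. l i powr p * (1 + t i powr (-(p - 1)))) + ln (2 / \<alpha>))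
                   / (\<Sum>i=1..n. l i)))} \<le> ?e n"
      by linarith
  qed (simp_all add: e_pos less_imp_le good_indices_def subset_iff)
qed

end
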